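(* Let $f\colon\mathbb{R}^n\to[-\infty,+\infty]$ be a proper nearly convex function and let $D\subset\mathbb{R}^n$ be a nonempty nearly convex set such that $(\mathrm{ri}\,D)\cap\mathrm{ri}(\mathrm{dom}\,f)\neq\emptyset$. Let $\mathcal S$ be the solution set of $\min\{f(x)\mid x\in D\}$ and $\mathcal S_1$ the solution set of $\min\{\bar f(x)\mid x\in\bar D\}$. Then $D\cap\mathrm{ri}(\mathrm{dom}\,\bar f)=D\cap\mathrm{ri}(\mathrm{dom}\,f)$, and any point $\bar x\in\mathcal S_1$ belonging to this set is a solution of $\min\{f(x)\mid x\in D\}$; in other words, $$\mathcal S_1\cap D\cap\mathrm{ri}(\mathrm{dom}\,\bar f)=\mathcal S_1\cap D\cap\mathrm{ri}(\mathrm{dom}\,f)\subset\mathcal S.$$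
   Context: A set $\Omega\subset\mathbb{R}^n$ is nearly convex if there is a convex set $C\subset\mathbb{R}^n$ with $C\subset\Omega\subset\bar C$, where the bar on a set denotes topological closure. For an arbitrary set $\Omega$, $\mathrm{ri}\,\Omega$ is the interior of $\Omega$ relative to its affine hull. For $f\colon\mathbb{R}^n\to[-\infty,+\infty]$: $\mathrm{dom}\,f=\{x\mid f(x)<+\infty\}$, $\mathrm{epi}\,f=\{(x,\lambda)\in\mathbb{R}^n\times\mathbb{R}\mid f(x)\le\lambda\}$; $f$ is proper if $\mathrm{dom}\,f\ne\emptyset$ and $f(x)>-\infty$ for all $x$; $f$ is nearly convex if $\mathrm{epi}\,f$ is a nearly convex set. The function $\bar f\colon\mathbb{R}^n\to[-\infty,+\infty]$ is defined by $\bar f(x)=\inf\{\alpha\in\mathbb{R}\mid (x,\alpha)\in\overline{\mathrm{epi}\,f}\}$, with $\inf\emptyset=+\infty$. A solution of a problem $\min\{h(x)\mid x\in E\}$ is a point $\bar x\in E$ with $h(\bar x)\le h(x)$ for all $x\in E$. *)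

theory Defs
  imports "HOL-Analysis.Analysis"
begin

definition nearly_convex :: "'a::real_normed_vector set \<Rightarrow> bool" where
  "nearly_convex A \<longleftrightarrow> (\<exists>C. convex C \<and> C \<subseteq> A \<and> A \<subseteq> closure C)"

definition edom :: "('a \<Rightarrow> ereal) \<Rightarrow> 'a set" where
  "edom f = {x. f x < \<infinity>}"

text \<open>The second component is a real number, never infinite, also where \<open>f\<close> takes the
  value \<open>-\<infinity>\<close>. The library's \<open>epigraph\<close> only covers real-valued functions.\<close>

definition epi :: "('a \<Rightarrow> ereal) \<Rightarrow> ('a \<times> real) set" where
  "epi f = {(x, r). f x \<le> ereal r}"

definition proper_fun :: "('a \<Rightarrow> ereal) \<Rightarrow> bool" where
  "proper_fun f \<longleftrightarrow> edom f \<noteq> {} \<and> (\<forall>x. f x > -\<infinity>)"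

definition nearly_convex_fun :: "('a::real_normed_vector \<Rightarrow> ereal) \<Rightarrow> bool" where
  "nearly_convex_fun f \<longleftrightarrow> nearly_convex (epi f)"

text \<open>The infimum is taken in the complete lattice \<open>ereal\<close>, so it is \<open>\<infinity>\<close> over the empty set.\<close>

definition fun_closure :: "('a::topological_space \<Rightarrow> ereal) \<Rightarrow> 'a \<Rightarrow> ereal" where
  "fun_closure f x = (INF r \<in> {r. (x, r) \<in> closure (epi f)}. ereal r)"

definition solution_set :: "('a \<Rightarrow> ereal) \<Rightarrow> 'a set \<Rightarrow> 'a set" where
  "solution_set h E = {x \<in> E. \<forall>y\<in>E. h x \<le> h y}"

end

(* A nearly convex set has the same relative interior as any convex set C sandwiching it.
   If C sandwiches epi f, its projection sandwiches both dom f and the domain of the closure of f,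
   so these domains have equal relative interiors.  A point x of this relative interior lifts to some
   (x, s) in ri C; for (x, r) in the closure of C the open segment from (x, s) to (x, r) lies
   in C, hence in epi f, and so f x <= r.  Thus f agrees with its closure at x, and minimality
   of x passes from the closure, which minorizes f, to f. *)

theory Submission
  imports Defs
begin

text \<open>The sandwich forces equal closures, hence equal affine hulls. Among sets with a common
  affine hull \<open>rel_interior\<close> is monotone, and a convex set has the same relative
  interior as its closure.\<close>

lemma rel_interior_nearly_convex:
  fixes A C :: "'a::euclidean_space set"
  assumes "convex C" "C \<subseteq> A" "A \<subseteq> closure C"
  shows "rel_interior A = rel_interior C"
proof -
  have cl: "closure A = closure C"
    using assms by (simp add: closure_minimal closure_mono subset_antisym)
  then have aff: "affine hull A = affine hull C"
    by (metis closure_same_affine_hull)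
  show ?thesis
  proof (rule subset_antisym)
    show "rel_interior C \<subseteq> rel_interior A"
      using assms(2) aff by (simp add: subset_rel_interior)
    have "rel_interior A \<subseteq> rel_interior (closure C)"
      using assms(3) aff by (simp add: subset_rel_interior)
    then show "rel_interior A \<subseteq> rel_interior C"
      by (simp add: convex_rel_interior_closure[OF assms(1)])
  qed
qed

lemma edom_eq_fst_epi: "edom f = fst ` epi f"
proof -
  have "\<exists>r. f x \<le> ereal r" if "f x < \<infinity>" for x
    using that by (cases "f x") auto
  then show ?thesis
    by (force simp: edom_def epi_def)
qed

text \<open>An infimum of reals is below \<infinity> exactly when some real competes; the empty set
  gives \<infinity>, and an unbounded fibre giving -\<infinity> still counts.\<close>

lemma edom_fun_closure: "edom (fun_closure f) = fst ` closure (epi f)"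
proof -
  have "fun_closure f x < \<infinity> \<longleftrightarrow> (\<exists>r. (x, r) \<in> closure (epi f))" for x
    unfolding fun_closure_def INF_less_iff by auto
  then show ?thesis
    by (force simp: edom_def)
qed

lemma fun_closure_le:
  fixes f :: "'a::topological_space \<Rightarrow> ereal"
  shows "fun_closure f x \<le> f x"
\<comment> \<open>Testing against real upper bounds of \<open>f x\<close> handles infinite values
  without a case split.\<close>
proof (rule ereal_le_real)
  fix r assume "f x \<le> ereal r"
  then have "(x, r) \<in> closure (epi f)"
    using closure_subset by (fastforce simp: epi_def)
  then show "fun_closure f x \<le> ereal r"
    unfolding fun_closure_def by (auto intro: INF_lower)
qed

lemma rel_interior_edom_sandwich:
  fixes f :: "'a::euclidean_space \<Rightarrow> ereal"
  assumes "convex C" "C \<subseteq> epi f" "epi f \<subseteq> closure C"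
  shows "rel_interior (edom f) = fst ` rel_interior C"
    and "rel_interior (edom (fun_closure f)) = fst ` rel_interior C"
proof -
  have conv: "convex (fst ` C)"
    by (rule convex_linear_image[OF linear_fst assms(1)])
  have proj: "rel_interior (fst ` C) = fst ` rel_interior C"
    by (rule rel_interior_convex_linear_image[OF linear_fst assms(1), symmetric])
  have cl: "fst ` closure C \<subseteq> closure (fst ` C)"
    by (rule closure_linear_image_subset[OF linear_fst])
  have epi: "closure (epi f) = closure C"
    using assms by (simp add: closure_minimal closure_mono subset_antisym)
  have "rel_interior (edom f) = rel_interior (fst ` C)"
    using assms cl by (intro rel_interior_nearly_convex conv) (auto simp: edom_eq_fst_epi)
  then show "rel_interior (edom f) = fst ` rel_interior C"
    by (simp only: proj)
  have "rel_interior (edom (fun_closure f)) = rel_interior (fst ` C)"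
    using cl closure_subset[of C]
    by (intro rel_interior_nearly_convex conv) (auto simp: edom_fun_closure epi)
  then show "rel_interior (edom (fun_closure f)) = fst ` rel_interior C"
    by (simp only: proj)
qed

lemma rel_interior_edom_fun_closure:
  fixes f :: "'a::euclidean_space \<Rightarrow> ereal"
  assumes "nearly_convex_fun f"
  shows "rel_interior (edom (fun_closure f)) = rel_interior (edom f)"
  using assms rel_interior_edom_sandwich[of _ f]
  unfolding nearly_convex_fun_def nearly_convex_def by metis

lemma fun_closure_eq_on_rel_interior:
  fixes f :: "'a::euclidean_space \<Rightarrow> ereal"
  assumes "nearly_convex_fun f" "x \<in> rel_interior (edom f)"
  shows "fun_closure f x = f x"
proof (rule antisym[OF fun_closure_le])
  obtain C where C: "convex C" "C \<subseteq> epi f" "epi f \<subseteq> closure C"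
    using assms(1) by (auto simp: nearly_convex_fun_def nearly_convex_def)
  obtain s where s: "(x, s) \<in> rel_interior C"
    using assms(2) rel_interior_edom_sandwich(1)[OF C] by force
  show "f x \<le> fun_closure f x"
    unfolding fun_closure_def
  proof (rule INF_greatest)
    fix r assume "r \<in> {r. (x, r) \<in> closure (epi f)}"
    then have r: "(x, r) \<in> closure C"
      using C(3) closure_minimal[of "epi f" "closure C"] by auto
    \<comment> \<open>Both endpoints lie over \<open>x\<close>, so the segment is vertical and
      bounds \<open>f\<close> at \<open>x\<close> itself. The value \<open>e = 0\<close> is excluded
      because \<open>(x, r)\<close> is only known to lie in the closure.\<close>
    have below: "f x \<le> ereal (r - e * (r - s))" if "0 < e" "e \<le> 1" for e
    proof -
      have "(x, r) - e *\<^sub>R ((x, r) - (x, s)) \<in> rel_interior C"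
        using rel_interior_closure_convex_shrink[OF C(1) s r that] .
      then have "(x, r - e * (r - s)) \<in> epi f"
        using rel_interior_subset C(2) by auto
      then show ?thesis
        by (simp add: epi_def)
    qed
    \<comment> \<open>Letting \<open>e\<close> tend to 0 from the right recovers the bound at
      \<open>r\<close>, since a non-strict inequality survives the limit.\<close>
    have "((\<lambda>e. r - e * (r - s)) \<longlongrightarrow> r - 0 * (r - s)) (at_right 0)"
      by (intro tendsto_intros)
    then have "((\<lambda>e. ereal (r - e * (r - s))) \<longlongrightarrow> ereal r) (at_right 0)"
      by simp
    moreover have "\<forall>\<^sub>F e in at_right 0. f x \<le> ereal (r - e * (r - s))"
      using below by (auto simp: eventually_at_right_field intro!: exI[of _ 1])
    ultimately show "f x \<le> ereal r"
      by (intro tendsto_lowerbound) auto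
  qed
qed

theorem corollary3p2:
  fixes f :: "real ^ 'n \<Rightarrow> ereal" and D :: "(real ^ 'n) set"
  assumes "proper_fun f"
    and "nearly_convex_fun f"
    and "D \<noteq> {}"
    and "nearly_convex D"
    and "rel_interior D \<inter> rel_interior (edom f) \<noteq> {}"
  shows "D \<inter> rel_interior (edom (fun_closure f)) = D \<inter> rel_interior (edom f)
    \<and> solution_set (fun_closure f) (closure D) \<inter> D \<inter> rel_interior (edom (fun_closure f))
       = solution_set (fun_closure f) (closure D) \<inter> D \<inter> rel_interior (edom f)
    \<and> solution_set (fun_closure f) (closure D) \<inter> D \<inter> rel_interior (edom f)
       \<subseteq> solution_set f D"
proof -
  have "x \<in> solution_set f D"
    if x: "x \<in> solution_set (fun_closure f) (closure D)" "x \<in> D" "x \<in> rel_interior (edom f)" for x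
  proof -
    \<comment> \<open>Equality of the two functions is used only at \<open>x\<close>; at
      \<open>y\<close>, which may lie outside the relative interior, minorization suffices.\<close>
    have "f x \<le> f y" if "y \<in> D" for y
    proof -
      have "f x = fun_closure f x"
        using fun_closure_eq_on_rel_interior[OF assms(2) x(3)] by simp
      also have "\<dots> \<le> fun_closure f y"
        using x(1) \<open>y \<in> D\<close> closure_subset by (auto simp: solution_set_def)
      also have "\<dots> \<le> f y"
        by (rule fun_closure_le)
      finally show ?thesis .
    qed
    with x(2) show ?thesis
      by (simp add: solution_set_def)
  qed
  then show ?thesis
    using rel_interior_edom_fun_closure[OF assms(2)] by auto
qed

end
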